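(* Let $X\in\{A,B\}$ be a $d$-dimensional quantum system ($d\ge 2$) with non-degenerate Hamiltonian, let $\gamma_X$ be its thermal state at a temperature $T_X>0$, and let $P^X_{\min}$ be the smallest eigenvalue of $\gamma_X$. Let $t_U>0$ be the time needed to perform a single unitary and $\tau_{\gamma_X},\tau_{\eta_X}\in(0,\infty)$ the thermalization time scales associated with $\gamma_X$ and $\eta_X:=\gamma_X+\frac{dP^X_{\min}}{1-dP^X_{\min}}\big(\gamma_X-\frac{\mathbb{I}_X}{d}\big)$. If $$\tau_{\gamma_X}>t_U\times\frac{8}{\ln 2},$$ then for every state $\rho_X\neq\gamma_X$ and every $p_*\in(0,1)$ there exists $\delta'>0$ such that for every $\delta\in(0,\delta')$, with $N_\delta:=\left\lceil 8\log_2\frac{d^2P^X_{\min}\sqrt2}{\delta}\right\rceil$, there exist times $t_1,t_2$ such that: 1. the random channel $\Lambda_X^{(N_\delta,t_1)}$ $\delta$-thermalizes $\rho_X$ to $\gamma_X$ with success probability (at least) $1-\left[\frac{\delta}{d^2P^X_{\min}\sqrt2}\right]^4$, and this quantity is larger than $p_*$; 2. $\mathcal{P}^t_{\gamma_X}$ $\delta$-thermalizes $\rho_X$ to $\gamma_X$ only if $t\ge t_2$; 3. $t_1<t_2$.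
   Context: The thermal state of a Hamiltonian $H_X$ at temperature $T_X>0$ is $\gamma_X=e^{-H_X/kT_X}/\mathrm{tr}(e^{-H_X/kT_X})$, $k>0$ Boltzmann's constant. $\|\cdot\|_\infty$ is the operator norm. A channel $\Lambda$ $\delta$-thermalizes a state $\rho$ to a thermal state $\gamma$ if $\|\Lambda(\rho)-\gamma\|_\infty<\delta$. Partial thermalization: for a state $\gamma$ with associated time scale $\tau_\gamma\in(0,\infty)$ and $t\ge0$, $\mathcal{P}^t_\gamma(\rho)=e^{-t/\tau_\gamma}\rho+(1-e^{-t/\tau_\gamma})\gamma$ on states $\rho$. Approximate twirling: let $U_1,\dots,U_N$ be independent Haar-random unitaries in $U(d)$, $\mathbf U=(U_1,\dots,U_N)$. On the bipartite system $AB$ one applies $\mathcal{T}^{(N)}_{\mathbf U}=\prod_{k=1}^N\mathcal{T}_k$ (composition), $\mathcal{T}_k(\cdot)=\frac12(\cdot)+\frac12(U_k\otimes U_k^* )(\cdot)(U_k\otimes U_k^* )^\dagger$. Its local action on $X$ is $\mathcal{T}^{(N)}_{\mathbf U,X}=\prod_{k=1}^N\mathcal{T}_{k,X}$ with $\mathcal{T}_{k,A}(\rho)=\frac12\rho+\frac12U_k\rho U_k^\dagger$ and $\mathcal{T}_{k,B}(\rho)=\frac12\rho+\frac12U_k^*\rho (U_k^{*})^\dagger$. For $N\in\mathbb{N}$ and a total implementation time $t\ge Nt_U$, the random channel (depending on $\mathbf U$) is $\Lambda_X^{(N,t)}=\mathcal{P}^{t_X}_{\eta_X}\circ\mathcal{T}^{(N)}_{\mathbf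 U,X}$, where $t_X=t-Nt_U$ is the duration of the partial thermalization, i.e. the total time $t$ consists of time $Nt_U$ for the $N$ unitaries plus $t_X$ for the partial thermalization. The success probability in item 1 refers to the randomness of $\mathbf U$. *)

theory Defs
  imports "HOL-Probability.Probability"
begin

type_synonym 'n cmatrix = "((complex, 'n) vec, 'n) vec"

subsection \<open>Matrices, states and Hamiltonians\<close>

definition adjoint_mat :: "'n::finite cmatrix \<Rightarrow> 'n cmatrix" where
  "adjoint_mat M = transpose (map_matrix cnj M)"

definition hermitian :: "'n::finite cmatrix \<Rightarrow> bool" where
  "hermitian M \<longleftrightarrow> adjoint_mat M = M"

definition unitary_group :: "'n::finite cmatrix set" where
  "unitary_group = {U. adjoint_mat U ** U = mat 1 \<and> U ** adjoint_mat U = mat 1}"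

definition eigenvalue :: "'n::finite cmatrix \<Rightarrow> complex \<Rightarrow> bool" where
  "eigenvalue M c \<longleftrightarrow> (\<exists>v. v \<noteq> 0 \<and> M *v v = c *s v)"

definition non_degenerate :: "'n::finite cmatrix \<Rightarrow> bool" where
  "non_degenerate M \<longleftrightarrow> (\<forall>c. eigenvalue M c \<longrightarrow> vec.dim {v. M *v v = c *s v} = 1)"

definition state :: "'n::finite cmatrix \<Rightarrow> bool" where
  "state \<rho> \<longleftrightarrow> hermitian \<rho> \<and> (\<forall>v. 0 \<le> Re (\<Sum>i\<in>UNIV. cnj (v $ i) * (\<rho> *v v) $ i)) \<and> trace \<rho> = 1"

text \<open>The norm on \<^typ>\<open>(complex, 'n) vec\<close> is the Euclidean one, so this is the usual operator
  norm, whereas \<^const>\<open>norm\<close> on matrices is the Frobenius norm.\<close>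

definition op_norm :: "'n::finite cmatrix \<Rightarrow> real" where
  "op_norm M = onorm ((*v) M)"

text \<open>The overloaded multiplication of \<^type>\<open>vec\<close> is entrywise, so the exponential series is
  written with iterated matrix products.\<close>

definition mat_exp :: "'n::finite cmatrix \<Rightarrow> 'n cmatrix" where
  "mat_exp M = (\<Sum>m. (1 / fact m) *\<^sub>R (((**) M ^^ m) (mat 1)))"

definition thermal_state :: "real \<Rightarrow> real \<Rightarrow> 'n::finite cmatrix \<Rightarrow> 'n cmatrix" where
  "thermal_state k T H =
     (let E = mat_exp ((- 1 / (k * T)) *\<^sub>R H) in map_matrix (\<lambda>z. z / trace E) E)"

definition min_eigenvalue :: "'n::finite cmatrix \<Rightarrow> real" where
  "min_eigenvalue M = Min {p. eigenvalue M (complex_of_real p)}"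

definition eta_state :: "'n::finite cmatrix \<Rightarrow> 'n cmatrix" where
  "eta_state \<gamma> =
     (let d = real CARD('n); P = min_eigenvalue \<gamma>
      in \<gamma> + (d * P / (1 - d * P)) *\<^sub>R (\<gamma> - (1 / d) *\<^sub>R mat 1))"

subsection \<open>Channels\<close>

definition thermalizes ::
  "real \<Rightarrow> ('n::finite cmatrix \<Rightarrow> 'n cmatrix) \<Rightarrow> 'n cmatrix \<Rightarrow> 'n cmatrix \<Rightarrow> bool" where
  "thermalizes \<delta> \<Lambda> \<rho> \<gamma> \<longleftrightarrow> op_norm (\<Lambda> \<rho> - \<gamma>) < \<delta>"

definition partial_thermalization ::
  "real \<Rightarrow> 'n::finite cmatrix \<Rightarrow> real \<Rightarrow> 'n cmatrix \<Rightarrow> 'n cmatrix" where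
  "partial_thermalization \<tau> \<gamma> t \<rho> = exp (- t / \<tau>) *\<^sub>R \<rho> + (1 - exp (- t / \<tau>)) *\<^sub>R \<gamma>"

datatype subsystem = Sys_A | Sys_B

text \<open>\<open>U \<otimes> U\<^sup>*\<close> acts as \<open>U\<close> on \<open>A\<close> and as the entrywise conjugate \<open>U\<^sup>*\<close> on \<open>B\<close>.\<close>

fun local_unitary :: "subsystem \<Rightarrow> 'n::finite cmatrix \<Rightarrow> 'n cmatrix" where
  "local_unitary Sys_A U = U"
| "local_unitary Sys_B U = map_matrix cnj U"

definition twirl_step :: "subsystem \<Rightarrow> 'n::finite cmatrix \<Rightarrow> 'n cmatrix \<Rightarrow> 'n cmatrix" where
  "twirl_step X U \<rho> =
     (let V = local_unitary X U in (1/2) *\<^sub>R \<rho> + (1/2) *\<^sub>R (V ** \<rho> ** adjoint_mat V))"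

text \<open>\<open>approx_twirl X N U = T\<^sub>1 \<circ> T\<^sub>2 \<circ> \<dots> \<circ> T\<^sub>N\<close>, using the unitaries \<open>U 1, \<dots>, U N\<close>.\<close>

primrec approx_twirl ::
  "subsystem \<Rightarrow> nat \<Rightarrow> (nat \<Rightarrow> 'n::finite cmatrix) \<Rightarrow> 'n cmatrix \<Rightarrow> 'n cmatrix" where
  "approx_twirl X 0 U = id"
| "approx_twirl X (Suc N) U = approx_twirl X N U \<circ> twirl_step X (U (Suc N))"

text \<open>\<open>t\<close> is the total implementation time, so the definition is meaningful for \<open>t \<ge> N t\<^sub>U\<close>.\<close>

definition random_channel ::
  "subsystem \<Rightarrow> 'n::finite cmatrix \<Rightarrow> real \<Rightarrow> real \<Rightarrow> nat \<Rightarrow> real \<Rightarrow> (nat \<Rightarrow> 'n cmatrix)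
     \<Rightarrow> 'n cmatrix \<Rightarrow> 'n cmatrix" where
  "random_channel X \<eta> \<tau> t\<^sub>U N t U =
     partial_thermalization \<tau> \<eta> (t - real N * t\<^sub>U) \<circ> approx_twirl X N U"

subsection \<open>Haar-random unitaries\<close>

definition haar_measure :: "'n::finite cmatrix measure \<Rightarrow> bool" where
  "haar_measure \<mu> \<longleftrightarrow> prob_space \<mu> \<and> sets \<mu> = sets (restrict_space borel unitary_group) \<and>
     (\<forall>V\<in>unitary_group. distr \<mu> \<mu> (\<lambda>U. V ** U) = \<mu>)"

text \<open>The product measure is the joint law of independent \<open>U 1, \<dots>, U N\<close> with law \<open>\<mu>\<close>.\<close>

definition success_probability ::
  "'n::finite cmatrix measure \<Rightarrow> nat \<Rightarrow> ((nat \<Rightarrow> 'n cmatrix) \<Rightarrow> bool) \<Rightarrow> real" where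
  "success_probability \<mu> N Q =
     (let M = (\<Pi>\<^sub>M k\<in>{1..N}. \<mu>) in measure M {U \<in> space M. Q U})"

end

theory Submission
  imports Defs
begin

text \<open>With \<open>r = d P\<close> and the partial thermalization stopped when the weight of the initial state has
  dropped to \<open>r\<close>, the definition of \<open>\<eta>\<close> makes the output of the random channel deviate from \<open>\<gamma>\<close>
  by exactly \<open>r (\<T>(\<rho>) - I/d)\<close>, where \<open>\<T>\<close> is the local twirl. The first moment of the Haar measure
  kills traceless matrices, so by unitary invariance of the Frobenius norm every twirling step
  halves the expected squared Frobenius norm of the traceless matrix \<open>\<rho> - I/d\<close>. Markov's inequality
  for the resulting bound \<open>2\<^sup>-\<^sup>N\<close> gives the success probability. The random channel therefore takes
  time about \<open>(8 t\<^sub>U / ln 2) ln (1/\<delta>)\<close>, whereas plain thermalization, whose deviation decays like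
  \<open>exp (- t / \<tau>\<^sub>\<gamma>)\<close>, needs about \<open>\<tau>\<^sub>\<gamma> ln (1/\<delta>)\<close>. The constants are meaningful since \<open>0 < d P < 1\<close>:
  the eigenvalues of an exponential are positive, and \<open>d P = 1\<close> would make \<open>\<gamma>\<close>, hence \<open>H\<close>, scalar.\<close>

subsection \<open>Hermitian matrices and thermal states\<close>

lemma adjoint_mat_nth [simp]: "adjoint_mat M $ i $ j = cnj (M $ j $ i)"
  by (simp add: adjoint_mat_def transpose_def)

lemma adjoint_mat_mult: "adjoint_mat (A ** B) = adjoint_mat B ** adjoint_mat A"
  by (simp add: vec_eq_iff matrix_matrix_mult_def mult.commute)

lemma adjoint_mat_adjoint_mat [simp]: "adjoint_mat (adjoint_mat M) = M"
  by (simp add: vec_eq_iff)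

lemma adjoint_mat_mat_1 [simp]: "adjoint_mat (mat 1) = mat 1"
  by (simp add: vec_eq_iff mat_def)

lemma inner_complex_eq_Re: "inner a b = Re (cnj a * b)"
  by (simp add: inner_complex_def)

text \<open>On complex vectors \<open>inner\<close> is the real part of the hermitian form. A
  hermitian matrix is therefore self-adjoint for a real inner product, and the real spectral theory
  below applies to it.\<close>

lemma inner_adjoint_mat: "inner (adjoint_mat M *v x) y = inner x (M *v y)"
proof -
  have "inner (adjoint_mat M *v x) y = (\<Sum>i\<in>UNIV. \<Sum>j\<in>UNIV. Re (M $ j $ i * cnj (x $ j) * y $ i))"
    by (simp add: inner_vec_def inner_complex_eq_Re matrix_vector_mult_def sum_distrib_right
        del: times_complex.simps)
  also have "\<dots> = (\<Sum>j\<in>UNIV. \<Sum>i\<in>UNIV. Re (M $ j $ i * cnj (x $ j) * y $ i))"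
    by (rule sum.swap)
  also have "\<dots> = inner x (M *v y)"
    by (simp add: inner_vec_def inner_complex_eq_Re matrix_vector_mult_def sum_distrib_left mult_ac
        del: times_complex.simps)
  finally show ?thesis .
qed

text \<open>The Frobenius inner product in trace form, so that cyclicity of the trace yields the
  unitary invariance of \<open>norm\<close> on matrices.\<close>

lemma inner_matrix_eq_trace: "inner A B = Re (trace (adjoint_mat A ** B))"
proof -
  have "inner A B = (\<Sum>i\<in>UNIV. \<Sum>j\<in>UNIV. Re (cnj (A $ i $ j) * B $ i $ j))"
    by (simp add: inner_vec_def inner_complex_eq_Re)
  also have "\<dots> = (\<Sum>j\<in>UNIV. \<Sum>i\<in>UNIV. Re (cnj (A $ i $ j) * B $ i $ j))"
    by (rule sum.swap)
  finally show ?thesis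
    by (simp add: trace_def matrix_matrix_mult_def)
qed

lemma norm_unitary_conj:
  assumes "adjoint_mat U ** U = mat 1"
  shows "norm (U ** M ** adjoint_mat U) = norm M"
proof -
  have "trace (adjoint_mat (U ** M ** adjoint_mat U) ** (U ** M ** adjoint_mat U))
      = trace (U ** (adjoint_mat M ** (adjoint_mat U ** U) ** M ** adjoint_mat U))"
    by (simp add: adjoint_mat_mult matrix_mul_assoc)
  also have "\<dots> = trace (adjoint_mat M ** (adjoint_mat U ** U) ** M ** (adjoint_mat U ** U))"
    by (subst trace_mul_sym) (simp add: matrix_mul_assoc)
  finally show ?thesis
    by (simp add: norm_eq_sqrt_inner inner_matrix_eq_trace assms)
qed

lemma trace_unitary_conj:
  assumes "adjoint_mat U ** U = mat 1"
  shows "trace (U ** M ** adjoint_mat U) = trace M"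
proof -
  have "trace (U ** M ** adjoint_mat U) = trace (M ** (adjoint_mat U ** U))"
    by (simp flip: matrix_mul_assoc) (subst trace_mul_sym, simp add: matrix_mul_assoc)
  then show ?thesis by (simp add: assms)
qed

lemma trace_scaleR: "trace (r *\<^sub>R M) = r *\<^sub>R trace M" for M :: "'n::finite cmatrix"
  by (simp add: trace_def scaleR_sum_right)

text \<open>Cauchy-Schwarz in each row. It puts the operator norm below the Frobenius norm, for
  which second moments can be computed exactly.\<close>

lemma norm_matrix_vector_mult_le:
  fixes M :: "'n::finite cmatrix"
  shows "norm (M *v v) \<le> norm M * norm v"
proof -
  have "norm ((M *v v) $ i) \<le> norm (M $ i) * norm v" for i
  proof -
    have "norm ((M *v v) $ i) \<le> (\<Sum>j\<in>UNIV. norm (M $ i $ j) * norm (v $ j))"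
      by (auto simp: matrix_vector_mult_def intro!: order.trans[OF norm_sum] sum_mono norm_mult_ineq)
    also have "\<dots> \<le> norm (M $ i) * norm v"
      using L2_set_mult_ineq[of "\<lambda>j. norm (M $ i $ j)" "\<lambda>j. norm (v $ j)" UNIV]
      by (simp add: norm_vec_def)
    finally show ?thesis .
  qed
  then have "norm (M *v v) \<le> L2_set (\<lambda>i. norm (M $ i) * norm v) UNIV"
    unfolding norm_vec_def[of "M *v v"] by (intro L2_set_mono) auto
  also have "\<dots> = norm M * norm v"
    by (simp add: norm_vec_def[of M] L2_set_left_distrib)
  finally show ?thesis .
qed

lemma op_norm_le_norm: "op_norm M \<le> norm M"
  unfolding op_norm_def by (rule onorm_le) (rule norm_matrix_vector_mult_le)

lemma scaleR_matrix_vector_mult: "(r *\<^sub>R M) *v v = r *\<^sub>R (M *v v)" for M :: "'n::finite cmatrix"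
  by (simp add: vec_eq_iff matrix_vector_mult_def scaleR_sum_right)

lemma op_norm_scaleR: "op_norm (r *\<^sub>R M) = \<bar>r\<bar> * op_norm M"
  unfolding op_norm_def
  using onorm_scaleR[of "(*v) M" r] by (simp flip: scaleR_matrix_vector_mult)

lemma op_norm_triangle: "op_norm (A + B) \<le> op_norm A + op_norm B"
  unfolding op_norm_def using onorm_triangle[of "(*v) A" "(*v) B"]
  by (simp flip: matrix_vector_mult_add_rdistrib)

lemma op_norm_pos: "op_norm M > 0" if "M \<noteq> 0"
  unfolding op_norm_def using that
  by (auto simp: onorm_pos_lt matrix_eq)

text \<open>For the measurability of the success event. The triangle inequality and the Frobenius
  bound make the operator norm 1-Lipschitz.\<close>

lemma continuous_on_op_norm: "continuous_on S (op_norm :: 'n::finite cmatrix \<Rightarrow> real)"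
proof (rule continuous_on_subset[OF _ subset_UNIV], rule lipschitz_on_continuous_on)
  show "1-lipschitz_on UNIV (op_norm :: 'n cmatrix \<Rightarrow> real)"
  proof (rule lipschitz_onI)
    fix A B :: "'n cmatrix"
    have "op_norm A \<le> norm (A - B) + op_norm B" for A B :: "'n cmatrix"
      using op_norm_triangle[of "A - B" B] op_norm_le_norm[of "A - B"] by simp
    from this[of A B] this[of B A] show "dist (op_norm A) (op_norm B) \<le> 1 * dist A B"
      by (auto simp: dist_norm norm_minus_commute)
  qed auto
qed

section \<open>Spectral theory of self-adjoint maps on real inner product spaces\<close>

lemma psd_null_vector:
  fixes g :: "'a::real_inner \<Rightarrow> 'a"
  assumes g: "linear g" and sym: "\<And>x y. inner (g x) y = inner x (g y)"
    and S: "subspace S" "\<And>x. x \<in> S \<Longrightarrow> g x \<in> S"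
    and psd: "\<And>w. w \<in> S \<Longrightarrow> 0 \<le> inner w (g w)"
    and v: "v \<in> S" "inner v (g v) = 0"
  shows "g v = 0"
proof (rule ccontr)
  assume "g v \<noteq> 0"
  define a where "a = inner (g v) (g v)"
  define c where "c = inner (g v) (g (g v))"
  have a: "a > 0" using \<open>g v \<noteq> 0\<close> by (simp add: a_def)
  have c: "c \<ge> 0" unfolding c_def using psd S v by blast
  \<comment> \<open>Moving from \<open>v\<close> against \<open>g v\<close> by a step
    \<open>t\<close> changes the form by \<open>t * (t * c - 2 * a)\<close>, which is negative for
    small \<open>t\<close>. This choice gives \<open>t * c \<le> a\<close>; the \<open>+ 1\<close>
    covers \<open>c = 0\<close>.\<close>
  define t where "t = a / (c + 1)"
  have "0 \<le> inner (v - t *\<^sub>R g v) (g (v - t *\<^sub>R g v))"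
    by (intro psd subspace_diff S subspace_scale v)
  also have "\<dots> = t * (t * c - 2 * a)"
    using v(2) sym[of v "g v"]
    by (simp add: linear_diff[OF g] linear_scale[OF g] inner_diff_left inner_diff_right a_def c_def
        algebra_simps)
  also have "\<dots> < 0"
  proof (rule mult_pos_neg)
    show "t > 0" using a c by (simp add: t_def)
    have "t * c \<le> a" using a c by (simp add: t_def field_simps)
    then show "t * c - 2 * a < 0" using a by simp
  qed
  finally show False by simp
qed

text \<open>The quadratic form attains a minimum \<open>l\<close> on the compact unit sphere of
  \<open>S\<close>. Then \<open>f - l\<close> is positive semidefinite on \<open>S\<close> and its
  form vanishes at the minimizer, which is therefore an eigenvector.\<close>

lemma selfadjoint_min_eigenvector:
  fixes f :: "'a::euclidean_space \<Rightarrow> 'a"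
  assumes f: "linear f" and sym: "\<And>x y. inner (f x) y = inner x (f y)"
    and S: "subspace S" "\<And>x. x \<in> S \<Longrightarrow> f x \<in> S" and "S \<noteq> {0}"
  obtains v l where "v \<in> S" "norm v = 1" "f v = l *\<^sub>R v"
    "\<And>w. w \<in> S \<Longrightarrow> l * (norm w)\<^sup>2 \<le> inner w (f w)"
proof -
  define C where "C = sphere 0 1 \<inter> S"
  from \<open>S \<noteq> {0}\<close> S(1) obtain u where u: "u \<in> S" "u \<noteq> 0"
    by (auto dest: subspace_0)
  have "u /\<^sub>R norm u \<in> C" using u S(1) by (simp add: C_def subspace_scale)
  then have ne: "C \<noteq> {}" by blast
  have "compact C" unfolding C_def
    by (intro compact_Int_closed closed_subspace S compact_sphere)
  moreover have cont: "continuous_on C (\<lambda>w. inner w (f w))"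
    by (intro continuous_intros linear_continuous_on_compose[OF _ f])
  ultimately obtain v where v: "v \<in> C" and min: "\<And>w. w \<in> C \<Longrightarrow> inner v (f v) \<le> inner w (f w)"
    using continuous_attains_inf[OF _ ne] by blast
  define l where "l = inner v (f v)"
  define g where "g = (\<lambda>w. f w - l *\<^sub>R w)"
  have nv: "norm v = 1" and vS: "v \<in> S" using v by (auto simp: C_def)
  have le: "l * (norm w)\<^sup>2 \<le> inner w (f w)" if "w \<in> S" for w
  proof (cases "w = 0")
    case False
    have "w /\<^sub>R norm w \<in> C" using that False S(1) by (simp add: C_def subspace_scale)
    from min[OF this] have "l \<le> inner w (f w) / (norm w)\<^sup>2"
      by (simp add: l_def linear_scale[OF f] power2_eq_square divide_inverse algebra_simps)
    then show ?thesis using False by (simp add: field_simps)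
  qed (simp add: linear_0[OF f])
  have "g v = 0"
  proof (rule psd_null_vector[of g S])
    show "linear g" unfolding g_def
      by (intro linearI) (simp_all add: linear_add[OF f] linear_scale[OF f] algebra_simps)
    show "inner v (g v) = 0"
      using nv by (simp add: g_def l_def inner_diff_right dot_square_norm)
  qed (use le S vS in \<open>auto simp: g_def sym inner_diff_left inner_diff_right power2_norm_eq_inner
      intro: subspace_diff subspace_scale\<close>)
  then show ?thesis using that[OF vS nv, of l] le by (simp add: g_def)
qed

text \<open>The orthogonal complement of the eigenvectors is invariant under \<open>f\<close>. If it
  were nonzero, it would contain an eigenvector, which would be orthogonal to itself.\<close>

lemma selfadjoint_eigenvectors_span:
  fixes f :: "'a::euclidean_space \<Rightarrow> 'a"
  assumes f: "linear f" and sym: "\<And>x y. inner (f x) y = inner x (f y)"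
  shows "span {v. \<exists>a. f v = a *\<^sub>R v} = UNIV"
proof -
  define E where "E = {v. \<exists>a. f v = a *\<^sub>R v}"
  define S where "S = E\<^sup>\<bottom>"
  have S: "x \<in> S \<longleftrightarrow> (\<forall>v\<in>E. inner v x = 0)" for x
    by (auto simp: S_def orthogonal_comp_def orthogonal_def)
  have "S = {0}"
  proof (rule ccontr)
    assume "S \<noteq> {0}"
    moreover have "subspace S" unfolding S_def by (rule subspace_orthogonal_comp)
    moreover have "f x \<in> S" if "x \<in> S" for x
      unfolding S
    proof
      fix v assume v: "v \<in> E"
      then obtain a where "f v = a *\<^sub>R v" by (auto simp: E_def)
      then have "inner v (f x) = a * inner v x" by (simp flip: sym)
      then show "inner v (f x) = 0" using v that by (simp add: S)
    qed
    ultimately obtain v l where "v \<in> S" "norm v = 1" "f v = l *\<^sub>R v"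
      using selfadjoint_min_eigenvector[OF f sym] by metis
    then have "inner v v = 0" by (auto simp: S E_def)
    with \<open>norm v = 1\<close> show False by simp
  qed
  have "x \<in> span E" for x
  proof -
    obtain y z where y: "y \<in> span E" and z: "\<And>w. w \<in> span E \<Longrightarrow> orthogonal z w" and x: "x = y + z"
      using orthogonal_subspace_decomp_exists[of E x] by blast
    have "z \<in> S" using z by (auto simp: S orthogonal_def inner_commute span_base)
    with \<open>S = {0}\<close> x y show ?thesis by simp
  qed
  then show ?thesis by (auto simp: E_def)
qed

section \<open>The matrix exponential and its eigenvectors\<close>

lemma bounded_linear_matrix_mult: "bounded_linear ((**) A :: 'n cmatrix \<Rightarrow> 'n cmatrix)" for A :: "'n::finite cmatrix"
  unfolding linear_conv_bounded_linear[symmetric]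
  by (intro linearI) (simp_all add: matrix_add_ldistrib matrix_scalar_ac scalar_matrix_assoc)

lemma bounded_linear_matrix_apply: "bounded_linear (\<lambda>M :: 'n::finite cmatrix. M *v v)"
  unfolding linear_conv_bounded_linear[symmetric]
  by (intro linearI) (simp_all add: matrix_vector_mult_add_rdistrib scaleR_matrix_vector_mult)

lemma bounded_linear_adjoint_mat: "bounded_linear adjoint_mat"
  unfolding linear_conv_bounded_linear[symmetric]
  by (intro linearI) (simp_all add: vec_eq_iff)

lemma summable_mat_exp:
  "summable (\<lambda>m. (1 / fact m) *\<^sub>R (((**) A ^^ m) (mat 1)))" for A :: "'n::finite cmatrix"
proof -
  \<comment> \<open>An operator bound for left multiplication by \<open>A\<close> dominates the
    terms by those of the scalar exponential series of \<open>K\<close>.\<close>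
  obtain K where K: "K > 0" "\<And>M :: 'n cmatrix. norm (A ** M) \<le> norm M * K"
    using bounded_linear.pos_bounded[OF bounded_linear_matrix_mult[of A]] by blast
  define c where "c = norm (mat 1 :: 'n cmatrix)"
  have pow: "norm (((**) A ^^ m) (mat 1)) \<le> c * K ^ m" for m
  proof (induction m)
    case (Suc m)
    have "norm (((**) A ^^ Suc m) (mat 1)) \<le> norm (((**) A ^^ m) (mat 1)) * K"
      using K(2) by simp
    also have "\<dots> \<le> c * K ^ m * K" using Suc K by (simp add: mult_right_mono)
    finally show ?case by (simp add: mult_ac)
  qed (simp add: c_def)
  have "summable (\<lambda>m. c * (inverse (fact m) * K ^ m))"
    by (intro summable_mult summable_exp)
  moreover have "norm ((1 / fact m) *\<^sub>R (((**) A ^^ m) (mat 1))) \<le> c * (inverse (fact m) * K ^ m)" for m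
    using mult_left_mono[OF pow[of m], of "inverse (fact m)"]
    by (simp add: divide_inverse mult_ac)
  ultimately show ?thesis by (rule summable_comparison_test'[where N = 0])
qed

lemma mat_exp_eigenvector:
  assumes "A *v v = a *\<^sub>R v"
  shows "mat_exp A *v v = exp a *\<^sub>R v"
proof -
  have pow: "(((**) A ^^ m) (mat 1)) *v v = a ^ m *\<^sub>R v" for m
  proof (induction m)
    case (Suc m)
    have "(((**) A ^^ Suc m) (mat 1)) *v v = A *v (((**) A ^^ m) (mat 1) *v v)"
      by (simp add: matrix_vector_mul_assoc)
    also have "\<dots> = a ^ m *\<^sub>R (A *v v)"
      by (simp only: Suc linear_scale[OF matrix_vector_mul_bounded_linear[THEN bounded_linear.linear]])
    finally show ?case by (simp add: assms)
  qed simp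
  have "mat_exp A *v v = (\<Sum>m. ((1 / fact m) *\<^sub>R (((**) A ^^ m) (mat 1))) *v v)"
    unfolding mat_exp_def by (rule bounded_linear.suminf[OF bounded_linear_matrix_apply summable_mat_exp])
  also have "\<dots> = (\<Sum>m. (a ^ m /\<^sub>R fact m) *\<^sub>R v)"
    by (simp add: scaleR_matrix_vector_mult pow divide_inverse mult_ac)
  also have "\<dots> = exp a *\<^sub>R v"
    unfolding exp_def by (rule suminf_scaleR_left[symmetric]) (rule summable_exp_generic)
  finally show ?thesis .
qed

lemma hermitian_mat_exp:
  assumes "hermitian A"
  shows "hermitian (mat_exp A)"
proof -
  \<comment> \<open>Taking adjoints reverses products and so moves the new factor \<open>A\<close>
    of a power to the right; commuting it back shows that powers are hermitian.\<close>
  have comm: "A ** ((**) A ^^ m) (mat 1) = ((**) A ^^ m) (mat 1) ** A" for m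
    by (induction m) (simp_all, metis matrix_mul_assoc)
  have pow: "adjoint_mat (((**) A ^^ m) (mat 1)) = ((**) A ^^ m) (mat 1)" for m
    using assms by (induction m) (simp_all add: adjoint_mat_mult hermitian_def comm)
  have "adjoint_mat (mat_exp A) = (\<Sum>m. adjoint_mat ((1 / fact m) *\<^sub>R (((**) A ^^ m) (mat 1))))"
    unfolding mat_exp_def by (rule bounded_linear.suminf[OF bounded_linear_adjoint_mat summable_mat_exp])
  also have "\<dots> = mat_exp A"
    by (simp add: mat_exp_def pow linear_scale[OF bounded_linear_adjoint_mat[THEN bounded_linear.linear]])
  finally show ?thesis by (simp add: hermitian_def)
qed

lemma hermitian_scaleR: "hermitian M \<Longrightarrow> hermitian (r *\<^sub>R M)"
  unfolding hermitian_def
  by (simp add: linear_scale[OF bounded_linear_adjoint_mat[THEN bounded_linear.linear]])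

lemma hermitian_inner: "hermitian M \<Longrightarrow> inner (M *v x) y = inner x (M *v y)"
  using inner_adjoint_mat[of M x y] by (simp add: hermitian_def)

lemma linear_matrix_apply: "linear ((*v) M)" for M :: "'n::finite cmatrix"
  by (rule bounded_linear.linear[OF matrix_vector_mul_bounded_linear])

section \<open>Eigenvalues of hermitian matrices and of thermal states\<close>

lemma eigenvalue_of_real: "eigenvalue M (complex_of_real p) \<longleftrightarrow> (\<exists>v. v \<noteq> 0 \<and> M *v v = p *\<^sub>R v)"
proof -
  have "complex_of_real p *s v = p *\<^sub>R v" for v :: "(complex, 'a) vec"
    by (simp add: vec_eq_iff scaleR_conv_of_real[where 'a = complex])
  then show ?thesis by (simp add: eigenvalue_def)
qed

text \<open>Eigenvectors for distinct eigenvalues are orthogonal, hence independent, so there are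
  only finitely many. This makes the \<open>Min\<close> in \<open>min_eigenvalue\<close>
  meaningful.\<close>

lemma finite_real_eigenvalues:
  assumes "hermitian M"
  shows "finite {p. eigenvalue M (complex_of_real p)}"
proof -
  define S where "S = {p. eigenvalue M (complex_of_real p)}"
  have "\<forall>p\<in>S. \<exists>v. v \<noteq> 0 \<and> M *v v = p *\<^sub>R v" by (simp add: S_def eigenvalue_of_real)
  then obtain f where f: "\<And>p. p \<in> S \<Longrightarrow> f p \<noteq> 0" "\<And>p. p \<in> S \<Longrightarrow> M *v f p = p *\<^sub>R f p"
    by metis
  have orth: "inner (f p) (f q) = 0" if "p \<in> S" "q \<in> S" "p \<noteq> q" for p q
    using hermitian_inner[OF assms, of "f p" "f q"] f that by simp
  have "pairwise orthogonal (f ` S)"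
    using orth by (auto simp: pairwise_def orthogonal_def)
  then have "independent (f ` S)"
    using f by (intro pairwise_orthogonal_independent) force+
  then have "finite (f ` S)" by (rule independent_imp_finite)
  moreover have "inj_on f S"
    by (rule inj_onI) (metis f(1) inner_eq_zero_iff orth)
  ultimately show ?thesis unfolding S_def[symmetric] by (rule finite_imageD)
qed

text \<open>Diagonal entries of a hermitian matrix are real, so the complex division by the trace in
  \<open>thermal_state\<close> is a real rescaling.\<close>

lemma hermitian_trace: "hermitian M \<Longrightarrow> trace M = complex_of_real (\<Sum>i\<in>UNIV. Re (M $ i $ i))"
proof -
  assume "hermitian M"
  then have "adjoint_mat M $ i $ i = M $ i $ i" for i by (simp add: hermitian_def)
  then have "M $ i $ i = complex_of_real (Re (M $ i $ i))" for i
    by (simp add: complex_eq_iff)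
  then show ?thesis unfolding trace_def of_real_sum by (intro sum.cong) auto
qed

lemma matrix_vector_mult_axis: "M *v axis i 1 = column i M"
  for M :: "'n::finite cmatrix"
  by (simp add: vec_eq_iff column_def matrix_vector_mult_def axis_def if_distrib cong: if_cong)

lemma inner_axis_matrix: "inner (axis i 1) (M *v axis i 1) = Re (M $ i $ i)"
  for M :: "'n::finite cmatrix"
  by (simp add: inner_axis' matrix_vector_mult_axis column_def inner_complex_def)

lemma hermitian_eigenvectors_span: "hermitian A \<Longrightarrow> span {v. \<exists>a. A *v v = a *\<^sub>R v} = UNIV"
  by (rule selfadjoint_eigenvectors_span[OF linear_matrix_apply hermitian_inner])

text \<open>An eigenvector \<open>w\<close> of the exponential is not orthogonal to some eigenvector of \<open>A\<close>, with
  eigenvalue \<open>a\<close> say; self-adjointness then gives \<open>p = exp a\<close>.\<close>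

lemma mat_exp_eigenvalue_pos:
  assumes "hermitian A" and w: "w \<noteq> 0" "mat_exp A *v w = p *\<^sub>R w"
  shows "p > 0"
proof -
  have "\<exists>v a. A *v v = a *\<^sub>R v \<and> inner w v \<noteq> 0"
  proof (rule ccontr)
    assume "\<nexists>v a. A *v v = a *\<^sub>R v \<and> inner w v \<noteq> 0"
    then have orth: "orthogonal w x" if "x \<in> {v. \<exists>a. A *v v = a *\<^sub>R v}" for x
      using that by (auto simp: orthogonal_def)
    have "w \<in> span {v. \<exists>a. A *v v = a *\<^sub>R v}"
      by (simp add: hermitian_eigenvectors_span[OF assms(1)])
    then have "orthogonal w w" by (rule orthogonal_to_span) (rule orth)
    with w show False by (simp add: orthogonal_self)
  qed
  then obtain v a where v: "A *v v = a *\<^sub>R v" "inner w v \<noteq> 0" by metis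
  have "inner (mat_exp A *v w) v = inner w (mat_exp A *v v)"
    by (rule hermitian_inner[OF hermitian_mat_exp[OF assms(1)]])
  then have "p = exp a" using v w by (simp add: mat_exp_eigenvector[OF v(1)])
  then show ?thesis by simp
qed

text \<open>Every nonzero eigenvector of \<open>A\<close> with eigenvalue \<open>a\<close> gives
  \<open>exp a = l\<close>, so all eigenvalues agree; since the eigenvectors span, \<open>A\<close>
  is scalar.\<close>

lemma mat_exp_scalar:
  assumes "hermitian A" and scalar: "\<And>v. mat_exp A *v v = l *\<^sub>R v"
  shows "A *v v = ln l *\<^sub>R v"
proof (rule linear_eq_on_span[of "(*v) A" "\<lambda>v. ln l *\<^sub>R v"])
  show "v \<in> span {v. \<exists>a. A *v v = a *\<^sub>R v}"
    by (simp add: hermitian_eigenvectors_span[OF assms(1)])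
  fix u assume "u \<in> {v. \<exists>a. A *v v = a *\<^sub>R v}"
  then obtain a where a: "A *v u = a *\<^sub>R u" by blast
  show "A *v u = ln l *\<^sub>R u"
  proof (cases "u = 0")
    case False
    have "exp a *\<^sub>R u = l *\<^sub>R u" using mat_exp_eigenvector[OF a] scalar by metis
    with False have "exp a = l" by (metis scaleR_cancel_right)
    then have "a = ln l" by auto
    with a show ?thesis by simp
  qed simp
qed (rule linear_matrix_apply linear_scaleR)+

text \<open>For a scalar matrix the whole space is one eigenspace, of complex dimension at least
  2.\<close>

lemma non_degenerate_not_scalar:
  fixes H :: "'n::finite cmatrix"
  assumes "non_degenerate H" "CARD('n) \<ge> 2"
  shows "\<not> (\<forall>v. H *v v = c *\<^sub>R v)"
proof
  assume *: "\<forall>v. H *v v = c *\<^sub>R v"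
  have "axis undefined 1 \<noteq> (0 :: (complex, 'n) vec)" by (simp add: axis_eq_0_iff)
  then have "eigenvalue H (complex_of_real c)" using * eigenvalue_of_real by blast
  then have "vec.dim {v. H *v v = complex_of_real c *s v} = 1"
    using assms by (simp add: non_degenerate_def)
  moreover have "{v. H *v v = complex_of_real c *s v} = UNIV"
    using * by (auto simp: vec_eq_iff scaleR_conv_of_real[where 'a = complex])
  ultimately show False using assms(2) vec_dim_card[where 'a = complex and 'n = 'n] by simp
qed

text \<open>Let \<open>l\<close> be the least eigenvalue of the unnormalized exponential
  \<open>E\<close> and \<open>Z\<close> its trace. Diagonal entries of \<open>E\<close> are Rayleigh
  quotients, so each is at least \<open>l\<close> and \<open>real CARD('n) * l \<le> Z\<close>.
  Together with \<open>P \<le> l / Z\<close> this bounds \<open>real CARD('n) * P\<close> by 1, and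
  equality would force \<open>E\<close> and then \<open>H\<close> to be scalar.\<close>

lemma thermal_state_min_eigenvalue:
  fixes H :: "'n::finite cmatrix"
  assumes H: "hermitian H" "non_degenerate H" and card: "CARD('n) \<ge> 2" and "k > 0" "T > 0"
  defines "P \<equiv> min_eigenvalue (thermal_state k T H)"
  shows "0 < P" "real CARD('n) * P < 1"
proof -
  define A where "A = (- 1 / (k * T)) *\<^sub>R H"
  have A: "hermitian A"
    unfolding A_def by (rule hermitian_scaleR[OF H(1)])
  define E where "E = mat_exp A"
  have E: "hermitian E" unfolding E_def by (rule hermitian_mat_exp[OF A])
  obtain v l where v: "norm v = 1" "E *v v = l *\<^sub>R v"
    and min: "\<And>w. l * (norm w)\<^sup>2 \<le> inner w (E *v w)"
    by (rule selfadjoint_min_eigenvector[of "(*v) E" UNIV])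
      (auto simp: linear_matrix_apply hermitian_inner[OF E] UNIV_not_singleton)
  have pos: "p > 0" if "w \<noteq> 0" "E *v w = p *\<^sub>R w" for w p
    using mat_exp_eigenvalue_pos[OF A] that by (simp add: E_def)
  have "l > 0" using pos[of v l] v by force
  define Z where "Z = (\<Sum>i\<in>UNIV. Re (E $ i $ i))"
  have diag: "l \<le> Re (E $ i $ i)" for i
    using min[of "axis i 1"] inner_axis_matrix[of i E] by (simp add: norm_eq_1[THEN iffD2] inner_axis_axis)
  have Zl: "real CARD('n) * l \<le> Z"
    using sum_mono[of UNIV "\<lambda>_. l", OF diag] by (simp add: Z_def)
  have Z: "Z > 0" using Zl \<open>l > 0\<close> by (smt (verit) mult_pos_pos of_nat_0_less_iff zero_less_card_finite)
  have th: "thermal_state k T H = (1 / Z) *\<^sub>R E"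
    unfolding thermal_state_def Let_def A_def[symmetric] E_def[symmetric] hermitian_trace[OF E] Z_def[symmetric]
    by (simp add: vec_eq_iff scaleR_conv_of_real[where 'a = complex])
  define S where "S = {p. eigenvalue (thermal_state k T H) (complex_of_real p)}"
  have S: "p \<in> S \<longleftrightarrow> (\<exists>w. w \<noteq> 0 \<and> E *v w = (Z * p) *\<^sub>R w)" for p
  proof -
    have "(1 / Z) *\<^sub>R (E *v w) = p *\<^sub>R w \<longleftrightarrow> E *v w = (Z * p) *\<^sub>R w" for w
      using Z by (metis (no_types, lifting) divide_self_if less_irrefl mult.commute scaleR_one
          scaleR_scaleR times_divide_eq_left mult_1)
    then show ?thesis
      by (simp add: S_def eigenvalue_of_real th scaleR_matrix_vector_mult)
  qed
  have fin: "finite S" unfolding S_def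
    unfolding th by (intro finite_real_eigenvalues hermitian_scaleR E)
  have lS: "l / Z \<in> S" using v Z unfolding S by (intro exI[of _ v]) auto
  have P: "P = Min S" by (simp add: P_def min_eigenvalue_def S_def)
  have "P \<in> S" unfolding P using fin lS by (intro Min_in) auto
  then have "Z * P > 0" using pos by (auto simp: S)
  then show "0 < P" using Z by (simp add: zero_less_mult_iff)
  have Ple: "P \<le> l / Z" unfolding P using fin lS by simp
  show "real CARD('n) * P < 1"
  proof (rule ccontr)
    assume "\<not> real CARD('n) * P < 1"
    then have "1 \<le> real CARD('n) * (l / Z)"
      using mult_left_mono[OF Ple, of "real CARD('n)"] by simp
    then have "real CARD('n) * l \<ge> Z" using Z by (simp add: field_simps)
    \<comment> \<open>Nonnegative differences with sum zero vanish. Every standard basis vector thus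
      minimizes the quadratic form and lies in the kernel of \<open>E - l\<close>.\<close>
    then have "(\<Sum>i\<in>UNIV. Re (E $ i $ i) - l) = 0"
      using Zl by (simp add: Z_def sum_subtractf)
    then have diag_eq: "Re (E $ i $ i) = l" for i
      using diag by (subst (asm) sum_nonneg_eq_0_iff) auto
    define g where "g = (\<lambda>w. E *v w - l *\<^sub>R w)"
    have g: "linear g" unfolding g_def
      by (intro linear_compose_sub linear_matrix_apply linear_scaleR)
    have "g (axis i 1) = 0" for i
    proof (rule psd_null_vector[OF g, where S = UNIV])
      show "inner (axis i 1) (g (axis i 1)) = 0"
        using diag_eq[of i] by (simp add: g_def inner_diff_right inner_axis_matrix inner_axis_axis)
    qed (use min in \<open>auto simp: g_def hermitian_inner[OF E] inner_diff_left inner_diff_right power2_norm_eq_inner\<close>)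
    then have "E *v axis i 1 = l *\<^sub>R axis i 1" for i by (simp add: g_def)
    then have "E $ j $ i = (l *\<^sub>R axis i 1) $ j" for i j
      by (simp add: matrix_vector_mult_axis column_def vec_eq_iff)
    then have "E = l *\<^sub>R mat 1"
      by (simp add: vec_eq_iff mat_def axis_def)
    then have "mat_exp A *v w = l *\<^sub>R w" for w
      by (simp add: E_def scaleR_matrix_vector_mult)
    from mat_exp_scalar[OF A this] have "A *v w = ln l *\<^sub>R w" for w .
    moreover have "H *v w = (- (k * T)) *\<^sub>R (A *v w)" for w
      using assms(4,5) by (simp only: A_def scaleR_matrix_vector_mult scaleR_scaleR) simp
    ultimately have "H *v w = (- (k * T) * ln l) *\<^sub>R w" for w by simp
    then show False using non_degenerate_not_scalar[OF H(2) card] by blast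
  qed
qed

subsection \<open>Twirling by Haar-random unitaries\<close>

lemma unitary_group_local_unitary:
  assumes "U \<in> unitary_group"
  shows "local_unitary X U \<in> unitary_group"
proof (cases X)
  case Sys_B
  have *: "map_matrix cnj A ** map_matrix cnj B = map_matrix cnj (A ** B)" for A B :: "'a cmatrix"
    by (simp add: vec_eq_iff matrix_matrix_mult_def)
  have "adjoint_mat (map_matrix cnj U) = map_matrix cnj (adjoint_mat U)"
    by (simp add: vec_eq_iff)
  then have "map_matrix cnj U \<in> unitary_group"
    using assms by (simp add: unitary_group_def *) (simp add: vec_eq_iff mat_def)
  then show ?thesis by (simp add: Sys_B)
qed (use assms in simp)

text \<open>Left translation by a real matrix survives entrywise conjugation, so left invariance of
  the Haar measure can be used in the same way on both subsystems.\<close>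

lemma local_unitary_mult_real:
  assumes "map_matrix cnj R = R"
  shows "local_unitary X (R ** U) = R ** local_unitary X U"
proof (cases X)
  case Sys_B
  have "cnj (R $ i $ j) = R $ i $ j" for i j
    using assms by (simp add: vec_eq_iff)
  then show ?thesis by (simp add: Sys_B vec_eq_iff matrix_matrix_mult_def)
qed simp

lemma unitary_group_mult:
  assumes "U \<in> unitary_group" "V \<in> unitary_group"
  shows "U ** V \<in> unitary_group"
proof -
  have "adjoint_mat V ** adjoint_mat U ** (U ** V) = adjoint_mat V ** (adjoint_mat U ** U) ** V"
    "U ** V ** (adjoint_mat V ** adjoint_mat U) = U ** (V ** adjoint_mat V) ** adjoint_mat U"
    by (simp_all only: matrix_mul_assoc)
  then show ?thesis using assms by (simp add: unitary_group_def adjoint_mat_mult)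
qed

text \<open>Signed permutation matrices are real, so passing to the entrywise conjugate on the second
  subsystem does not affect them, and conjugation invariance under them alone already forces a
  matrix to be scalar. This replaces Schur's lemma.\<close>

definition signed_perm :: "('n \<Rightarrow> real) \<Rightarrow> ('n \<Rightarrow> 'n) \<Rightarrow> 'n::finite cmatrix" where
  "signed_perm s f = (\<chi> a b. if b = f a then complex_of_real (s a) else 0)"

lemma signed_perm_real: "map_matrix cnj (signed_perm s f) = signed_perm s f"
  by (simp add: signed_perm_def vec_eq_iff)

lemma signed_perm_conj_nth:
  "(signed_perm s f ** M ** adjoint_mat (signed_perm s f)) $ i $ j
    = of_real (s i * s j) * M $ f i $ f j"
proof -
  have "(signed_perm s f ** M) $ i $ b = of_real (s i) * M $ f i $ b" for b
    by (simp add: matrix_matrix_mult_def signed_perm_def if_distribR if_distrib cong: if_cong)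
  then have "(signed_perm s f ** M ** adjoint_mat (signed_perm s f)) $ i $ j
      = (\<Sum>b\<in>UNIV. of_real (s i) * M $ f i $ b * (if b = f j then of_real (s j) else 0))"
    by (subst matrix_matrix_mult_def) (auto simp: signed_perm_def intro!: sum.cong)
  then show ?thesis
    by (simp add: if_distrib mult_ac cong: if_cong)
qed

lemma signed_perm_unitary:
  assumes "inj f" and "\<And>i. s i * s i = 1"
  shows "signed_perm s f \<in> unitary_group"
proof -
  have "(signed_perm s f ** mat 1 ** adjoint_mat (signed_perm s f)) = mat 1"
    using assms by (simp add: vec_eq_iff signed_perm_conj_nth mat_def inj_eq
        flip: of_real_mult)
  then show ?thesis
    by (simp add: unitary_group_def matrix_left_right_inverse)
qed

text \<open>A sign flip at \<open>i\<close> negates the off-diagonal entries of row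
  \<open>i\<close>, so they vanish. Transpositions exchange diagonal entries, so these are all
  equal, and the trace condition makes them zero.\<close>

lemma signed_perm_invariant_traceless:
  assumes inv: "\<And>s f. inj f \<Longrightarrow> (\<And>i. s i * s i = 1)
      \<Longrightarrow> signed_perm s f ** B ** adjoint_mat (signed_perm s f) = B"
    and "trace B = 0"
  shows "B = 0"
proof -
  have off: "B $ i $ j = 0" if "i \<noteq> j" for i j
  proof -
    define s where "s = (\<lambda>a. if a = i then -1 else 1 :: real)"
    have "signed_perm s id ** B ** adjoint_mat (signed_perm s id) = B"
      by (rule inv) (auto simp: s_def)
    from arg_cong[OF this, of "\<lambda>M. M $ i $ j"] show ?thesis
      using that by (simp add: signed_perm_conj_nth s_def)
  qed
  have diag: "B $ i $ i = B $ j $ j" for i j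
  proof -
    have "signed_perm (\<lambda>_. 1) (Transposition.transpose i j) ** B
        ** adjoint_mat (signed_perm (\<lambda>_. 1) (Transposition.transpose i j)) = B"
      by (rule inv) auto
    from arg_cong[OF this, of "\<lambda>M. M $ i $ i"] show ?thesis
      by (simp add: signed_perm_conj_nth)
  qed
  have "B $ i $ i = 0" for i
  proof -
    have "trace B = (\<Sum>a\<in>(UNIV :: 'a set). B $ i $ i)"
      unfolding trace_def by (intro sum.cong refl diag)
    then show ?thesis using assms(2) by simp
  qed
  with off show ?thesis by (metis vec_eq_iff zero_index)
qed

section \<open>Haar averages of unitary conjugation\<close>

lemma continuous_on_matrix_mult [continuous_intros]:
  fixes f g :: "'a::topological_space \<Rightarrow> 'n::finite cmatrix"
  assumes "continuous_on S f" "continuous_on S g"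
  shows "continuous_on S (\<lambda>x. f x ** g x)"
  unfolding matrix_matrix_mult_def by (intro continuous_intros assms)

lemma continuous_on_adjoint_mat [continuous_intros]:
  "continuous_on S f \<Longrightarrow> continuous_on S (\<lambda>x. adjoint_mat (f x))"
  by (rule bounded_linear.continuous_on[OF bounded_linear_adjoint_mat])

lemma continuous_on_local_unitary [continuous_intros]:
  fixes f :: "'a::topological_space \<Rightarrow> 'n::finite cmatrix"
  assumes "continuous_on S f"
  shows "continuous_on S (\<lambda>x. local_unitary X (f x))"
  by (cases X) (auto simp: map_matrix_def intro!: continuous_intros assms)

lemma matrix_add_rdistrib: "(A + B) ** C = A ** C + B ** C" for A B C :: "'n::finite cmatrix"
  by (simp add: vec_eq_iff matrix_matrix_mult_def sum.distrib distrib_right)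

lemma bounded_linear_conj: "bounded_linear (\<lambda>M. R ** M ** S)" for R S :: "'n::finite cmatrix"
  unfolding linear_conv_bounded_linear[symmetric]
  by (intro linearI) (simp_all add: matrix_add_ldistrib matrix_add_rdistrib matrix_scalar_ac
      scalar_matrix_assoc)

lemma haar_measurable:
  assumes "haar_measure \<mu>" "continuous_on UNIV f"
  shows "f \<in> borel_measurable \<mu>"
proof -
  have "f \<in> borel_measurable (restrict_space borel unitary_group)"
    using assms(2) by (intro measurable_restrict_space1 borel_measurable_continuous_onI)
  then show ?thesis
    using assms(1) measurable_cong_sets[of \<mu> "restrict_space borel unitary_group" borel borel]
    by (auto simp: haar_measure_def)
qed

lemma haar_space: "haar_measure \<mu> \<Longrightarrow> space \<mu> = unitary_group"
  by (auto simp: haar_measure_def space_restrict_space dest: sets_eq_imp_space_eq)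

lemma haar_conj_integrable:
  assumes "haar_measure \<mu>"
  shows "integrable \<mu> (\<lambda>U. local_unitary X U ** M ** adjoint_mat (local_unitary X U))"
proof -
  interpret prob_space \<mu> using assms by (simp add: haar_measure_def)
  show ?thesis
  proof (rule integrable_const_bound[where B = "norm M"])
    show "AE U in \<mu>. norm (local_unitary X U ** M ** adjoint_mat (local_unitary X U)) \<le> norm M"
    proof (rule AE_I2)
      fix U assume "U \<in> space \<mu>"
      then have "local_unitary X U \<in> unitary_group"
        by (simp add: haar_space[OF assms] unitary_group_local_unitary)
      then show "norm (local_unitary X U ** M ** adjoint_mat (local_unitary X U)) \<le> norm M"
        by (simp add: norm_unitary_conj unitary_group_def)
    qed
  qed (intro haar_measurable[OF assms] continuous_intros)
qed

text \<open>By left invariance of \<mu> the average is unchanged under conjugation by every signed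
  permutation matrix \<open>R\<close>. Its trace is the average of traces that are all zero, so it
  vanishes.\<close>

lemma haar_conj_integral_traceless:
  assumes \<mu>: "haar_measure \<mu>" and M: "trace M = 0"
  shows "(\<integral>U. local_unitary X U ** M ** adjoint_mat (local_unitary X U) \<partial>\<mu>) = 0"
proof -
  define W where "W = (\<lambda>U. local_unitary X U ** M ** adjoint_mat (local_unitary X U))"
  have int: "integrable \<mu> W" unfolding W_def by (rule haar_conj_integrable[OF \<mu>])
  have sets: "sets \<mu> = sets (restrict_space borel unitary_group)"
    using \<mu> by (simp add: haar_measure_def)
  have "integral\<^sup>L \<mu> W = 0"
  proof (rule signed_perm_invariant_traceless)
    fix s :: "'a \<Rightarrow> real" and f :: "'a \<Rightarrow> 'a"
    assume sf: "inj f" "\<And>i. s i * s i = 1"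
    define R where "R = signed_perm s f"
    have R: "R \<in> unitary_group" unfolding R_def by (rule signed_perm_unitary[OF sf])
    have "(**) R \<in> measurable \<mu> (restrict_space borel unitary_group)"
      by (intro measurable_restrict_space2 haar_measurable[OF \<mu>] continuous_intros)
        (auto simp: haar_space[OF \<mu>] unitary_group_mult R)
    then have meas: "(**) R \<in> measurable \<mu> \<mu>"
      using measurable_cong_sets[OF refl sets, of \<mu>] by simp
    have "integral\<^sup>L \<mu> W = integral\<^sup>L (distr \<mu> \<mu> ((**) R)) W"
      using \<mu> R by (simp add: haar_measure_def)
    also have "\<dots> = (\<integral>U. W (R ** U) \<partial>\<mu>)"
      by (rule integral_distr[OF meas]) (use int in simp)
    also have "\<dots> = (\<integral>U. R ** W U ** adjoint_mat R \<partial>\<mu>)"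
      by (simp add: W_def local_unitary_mult_real R_def signed_perm_real adjoint_mat_mult matrix_mul_assoc)
    also have "\<dots> = R ** integral\<^sup>L \<mu> W ** adjoint_mat R"
      by (rule integral_bounded_linear[OF bounded_linear_conj int])
    finally show "signed_perm s f ** integral\<^sup>L \<mu> W ** adjoint_mat (signed_perm s f) = integral\<^sup>L \<mu> W"
      by (simp add: R_def)
  next
    have bl: "bounded_linear (trace :: 'a cmatrix \<Rightarrow> complex)"
      unfolding linear_conv_bounded_linear[symmetric]
      by (intro linearI) (simp_all add: trace_add trace_scaleR)
    have "trace (integral\<^sup>L \<mu> W) = (\<integral>U. trace (W U) \<partial>\<mu>)"
      by (rule integral_bounded_linear[OF bl int, symmetric])
    also have "\<dots> = (\<integral>U. 0 \<partial>\<mu>)"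
    proof (rule Bochner_Integration.integral_cong[OF refl])
      fix U assume "U \<in> space \<mu>"
      then have "local_unitary X U \<in> unitary_group"
        by (simp add: haar_space[OF \<mu>] unitary_group_local_unitary)
      then show "trace (W U) = 0"
        using M by (simp add: W_def trace_unitary_conj unitary_group_def)
    qed
    finally show "trace (integral\<^sup>L \<mu> W) = 0" by simp
  qed
  then show ?thesis by (simp add: W_def)
qed

section \<open>Second moments of the twirl and concentration\<close>

lemma norm_twirl_step:
  assumes "U \<in> unitary_group"
  shows "(norm (twirl_step X U M))\<^sup>2 = (norm M)\<^sup>2 / 2
    + inner M (local_unitary X U ** M ** adjoint_mat (local_unitary X U)) / 2"
proof -
  define W where "W = local_unitary X U ** M ** adjoint_mat (local_unitary X U)"
  have "norm W = norm M"
    using unitary_group_local_unitary[OF assms, of X]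
    by (simp add: W_def norm_unitary_conj unitary_group_def)
  then have "inner W W = inner M M" by (simp add: norm_eq)
  then have "inner ((1/2) *\<^sub>R M + (1/2) *\<^sub>R W) ((1/2) *\<^sub>R M + (1/2) *\<^sub>R W) = inner M M / 2 + inner M W / 2"
    by (simp add: inner_add_left inner_add_right inner_commute[of W M] field_simps)
  then show ?thesis
    by (simp add: twirl_step_def Let_def W_def power2_norm_eq_inner)
qed

text \<open>Conjugation preserves the norm, so after expanding the square only the cross term
  depends on \<open>U\<close>. It is linear in the conjugated matrix, and the vanishing first Haar
  moment removes it.\<close>

lemma twirl_step_second_moment:
  assumes \<mu>: "haar_measure \<mu>" and M: "trace M = 0"
  shows "(\<integral>\<^sup>+U. ennreal ((norm (twirl_step X U M))\<^sup>2) \<partial>\<mu>) = ennreal ((norm M)\<^sup>2 / 2)"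
proof -
  interpret prob_space \<mu> using \<mu> by (simp add: haar_measure_def)
  define W where "W = (\<lambda>U. local_unitary X U ** M ** adjoint_mat (local_unitary X U))"
  have int: "integrable \<mu> W" unfolding W_def by (rule haar_conj_integrable[OF \<mu>])
  have eq: "(norm (twirl_step X U M))\<^sup>2 = (norm M)\<^sup>2 / 2 + inner M (W U) / 2" if "U \<in> space \<mu>" for U
    using that norm_twirl_step by (simp add: W_def haar_space[OF \<mu>])
  have "(\<integral>\<^sup>+U. ennreal ((norm (twirl_step X U M))\<^sup>2) \<partial>\<mu>)
      = (\<integral>\<^sup>+U. ennreal ((norm M)\<^sup>2 / 2 + inner M (W U) / 2) \<partial>\<mu>)"
    by (intro nn_integral_cong) (simp add: eq)
  also have "\<dots> = ennreal (\<integral>U. (norm M)\<^sup>2 / 2 + inner M (W U) / 2 \<partial>\<mu>)"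
    using int by (intro nn_integral_eq_integral AE_I2) (auto simp flip: eq)
  also have "(\<integral>U. (norm M)\<^sup>2 / 2 + inner M (W U) / 2 \<partial>\<mu>) = (norm M)\<^sup>2 / 2 + inner M (integral\<^sup>L \<mu> W) / 2"
    using int by (simp add: prob_space)
  also have "integral\<^sup>L \<mu> W = 0"
    unfolding W_def by (rule haar_conj_integral_traceless[OF \<mu> M])
  finally show ?thesis by simp
qed

lemma trace_twirl_step:
  assumes "U \<in> unitary_group"
  shows "trace (twirl_step X U M) = trace M"
proof -
  have "trace (local_unitary X U ** M ** adjoint_mat (local_unitary X U)) = trace M"
    using unitary_group_local_unitary[OF assms, of X]
    by (intro trace_unitary_conj) (simp add: unitary_group_def)
  then show ?thesis
    by (simp add: twirl_step_def Let_def trace_add trace_scaleR scaleR_conv_of_real[where 'a = complex])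
qed

text \<open>Unitary conjugation fixes the identity. Subtracting the maximally mixed state therefore
  commutes with twirling, which reduces the analysis to traceless matrices.\<close>

lemma twirl_step_diff_scalar:
  assumes "U \<in> unitary_group"
  shows "twirl_step X U (M - c *\<^sub>R mat 1) = twirl_step X U M - c *\<^sub>R mat 1"
proof -
  define V where "V = local_unitary X U"
  have "V ** mat 1 ** adjoint_mat V = mat 1"
    using unitary_group_local_unitary[OF assms, of X] by (simp add: unitary_group_def V_def)
  then have "V ** (M - c *\<^sub>R mat 1) ** adjoint_mat V = V ** M ** adjoint_mat V - c *\<^sub>R mat 1"
    by (simp add: linear_diff[OF bounded_linear_conj[THEN bounded_linear.linear]]
        linear_scale[OF bounded_linear_conj[THEN bounded_linear.linear]])
  then have "twirl_step X U (M - c *\<^sub>R mat 1)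
      = (1/2) *\<^sub>R M + (1/2) *\<^sub>R (V ** M ** adjoint_mat V) 
        - ((1/2) *\<^sub>R c *\<^sub>R mat 1 + (1/2) *\<^sub>R c *\<^sub>R mat 1)"
    by (simp add: twirl_step_def Let_def V_def[symmetric] scaleR_diff_right)
  also have "(1/2) *\<^sub>R c *\<^sub>R mat 1 + (1/2) *\<^sub>R c *\<^sub>R mat 1 = c *\<^sub>R (mat 1 :: 'a cmatrix)"
    by (simp flip: scaleR_add_left)
  finally show ?thesis by (simp add: twirl_step_def Let_def V_def)
qed

lemma approx_twirl_diff_scalar:
  assumes "\<And>k. k \<in> {1..N} \<Longrightarrow> U k \<in> unitary_group"
  shows "approx_twirl X N U (M - c *\<^sub>R mat 1) = approx_twirl X N U M - c *\<^sub>R mat 1"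
  using assms by (induction N arbitrary: M) (simp_all add: twirl_step_diff_scalar)

lemma approx_twirl_cong:
  "(\<And>k. k \<in> {1..N} \<Longrightarrow> U k = V k) \<Longrightarrow> approx_twirl X N U M = approx_twirl X N V M"
  by (induction N arbitrary: M) simp_all

text \<open>The input \<open>g\<close> may depend on \<open>U\<close> because the step with
  \<open>U (Suc N)\<close> acts first and hands a random matrix to the remaining steps. The product
  space, indexed up to \<open>n\<close>, stays fixed during the induction.\<close>

lemma approx_twirl_measurable:
  assumes \<mu>: "haar_measure \<mu>" and "N \<le> n"
    and "g \<in> borel_measurable (\<Pi>\<^sub>M k\<in>{1..n}. \<mu>)"
  shows "(\<lambda>U. approx_twirl X N U (g U)) \<in> borel_measurable (\<Pi>\<^sub>M k\<in>{1..n}. \<mu>)"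
  using assms(2,3)
proof (induction N arbitrary: g)
  case (Suc N)
  have "(\<lambda>U. U) \<in> borel_measurable \<mu>"
    by (intro haar_measurable[OF \<mu>] continuous_intros)
  then have "(\<lambda>U. U (Suc N)) \<in> borel_measurable (\<Pi>\<^sub>M k\<in>{1..n}. \<mu>)"
    using measurable_component_singleton[of "Suc N" "{1..n}" "\<lambda>_. \<mu>"] Suc.prems(1)
    by (auto intro: measurable_compose)
  moreover have "continuous_on UNIV (\<lambda>x. twirl_step X (fst x) (snd x))"
    unfolding twirl_step_def Let_def by (intro continuous_intros)
  ultimately have "(\<lambda>U. twirl_step X (U (Suc N)) (g U)) \<in> borel_measurable (\<Pi>\<^sub>M k\<in>{1..n}. \<mu>)"
    using borel_measurable_continuous_Pair[OF _ Suc.prems(2), of "\<lambda>U. U (Suc N)" "twirl_step X"]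
    by (simp add: case_prod_beta)
  from Suc.IH[OF _ this] Suc.prems show ?case by simp
qed simp

text \<open>By Fubini the unitary of the innermost step is integrated last. For each of its values
  the output of that step is again traceless, so the induction hypothesis, kept general in
  \<open>M\<close>, applies to it.\<close>

lemma approx_twirl_second_moment:
  assumes \<mu>: "haar_measure \<mu>" and "trace M = 0"
  shows "(\<integral>\<^sup>+U. ennreal ((norm (approx_twirl X N U M))\<^sup>2) \<partial>(\<Pi>\<^sub>M k\<in>{1..N}. \<mu>))
    = ennreal ((1/2) ^ N * (norm M)\<^sup>2)"
  using assms(2)
proof (induction N arbitrary: M)
  case 0
  then show ?case by (simp add: PiM_empty nn_integral_count_space_finite)
next
  case (Suc N)
  interpret prob_space \<mu> using \<mu> by (simp add: haar_measure_def)
  interpret product_sigma_finite "\<lambda>_::nat. \<mu>" by unfold_locales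
  have eq: "{1..Suc N} = insert (Suc N) {1..N}" by auto
  have "(\<integral>\<^sup>+U. ennreal ((norm (approx_twirl X (Suc N) U M))\<^sup>2) \<partial>(\<Pi>\<^sub>M k\<in>{1..Suc N}. \<mu>))
      = (\<integral>\<^sup>+V. \<integral>\<^sup>+U. ennreal ((norm (approx_twirl X (Suc N) (U(Suc N := V)) M))\<^sup>2)
          \<partial>(\<Pi>\<^sub>M k\<in>{1..N}. \<mu>) \<partial>\<mu>)"
    unfolding eq
    by (rule product_nn_integral_insert_rev)
      (use approx_twirl_measurable[OF \<mu> order_refl, of "\<lambda>_. M" "Suc N" X] in
        \<open>simp_all only: eq finite_atLeastAtMost, simp_all\<close>)
  also have "\<dots> = (\<integral>\<^sup>+V. \<integral>\<^sup>+U. ennreal ((norm (approx_twirl X N U (twirl_step X V M)))\<^sup>2)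
          \<partial>(\<Pi>\<^sub>M k\<in>{1..N}. \<mu>) \<partial>\<mu>)"
  proof -
    \<comment> \<open>\<open>approx_twirl X N\<close> reads only the coordinates \<open>1\<close> to
      \<open>N\<close>, so it does not see the update at \<open>Suc N\<close>.\<close>
    have "approx_twirl X (Suc N) (U(Suc N := V)) M = approx_twirl X N U (twirl_step X V M)" for U V
      by simp (rule approx_twirl_cong, auto)
    then show ?thesis by simp
  qed
  also have "\<dots> = (\<integral>\<^sup>+V. ennreal ((1/2) ^ N) * ennreal ((norm (twirl_step X V M))\<^sup>2) \<partial>\<mu>)"
  proof (rule nn_integral_cong)
    fix V assume "V \<in> space \<mu>"
    then have "trace (twirl_step X V M) = 0"
      by (simp add: trace_twirl_step haar_space[OF \<mu>] Suc.prems)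
    from Suc.IH[OF this]
    show "(\<integral>\<^sup>+U. ennreal ((norm (approx_twirl X N U (twirl_step X V M)))\<^sup>2) \<partial>(\<Pi>\<^sub>M k\<in>{1..N}. \<mu>))
        = ennreal ((1/2) ^ N) * ennreal ((norm (twirl_step X V M))\<^sup>2)"
      by (simp add: ennreal_mult)
  qed
  also have "\<dots> = ennreal ((1/2) ^ N) * (\<integral>\<^sup>+V. ennreal ((norm (twirl_step X V M))\<^sup>2) \<partial>\<mu>)"
    unfolding twirl_step_def Let_def
    by (intro nn_integral_cmult measurable_compose[OF haar_measurable[OF \<mu>] measurable_ennreal] continuous_intros)
  also have "\<dots> = ennreal ((1/2) ^ Suc N * (norm M)\<^sup>2)"
    by (simp add: twirl_step_second_moment[OF \<mu> Suc.prems] flip: ennreal_mult)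
  finally show ?case .
qed

text \<open>Markov's inequality for the squared Frobenius norm divided by \<open>c\<^sup>2\<close>.
  Failure in operator norm implies failure in Frobenius norm, and the shift by the fixed point
  \<open>R\<close> makes the matrix traceless.\<close>

lemma approx_twirl_concentration:
  fixes \<rho> :: "'n::finite cmatrix" and N :: nat
  assumes \<mu>: "haar_measure \<mu>" and "trace \<rho> = 1" and c: "c > 0"
  defines "M \<equiv> \<Pi>\<^sub>M k\<in>{1..N}. \<mu>" and "R \<equiv> (1 / real CARD('n)) *\<^sub>R (mat 1 :: 'n cmatrix)"
  shows "measure M {U \<in> space M. op_norm (approx_twirl X N U \<rho> - R) < c}
    \<ge> 1 - (1/2) ^ N * (norm (\<rho> - R))\<^sup>2 / c\<^sup>2"
proof -
  interpret \<mu>: prob_space \<mu> using \<mu> by (simp add: haar_measure_def)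
  interpret product_prob_space "\<lambda>_::nat. \<mu>" "{1..N}" by unfold_locales
  interpret M: prob_space M unfolding M_def by (rule prob_space_axioms)
  have tr: "trace (\<rho> - R) = 0"
    by (simp add: trace_sub assms(2) R_def trace_scaleR trace_I scaleR_conv_of_real[where 'a = complex])
  have shift: "approx_twirl X N U (\<rho> - R) = approx_twirl X N U \<rho> - R" if "U \<in> space M" for U
    unfolding R_def using that
    by (intro approx_twirl_diff_scalar) (auto simp: M_def space_PiM PiE_iff haar_space[OF \<mu>])
  define f where "f = (\<lambda>U. (norm (approx_twirl X N U (\<rho> - R)))\<^sup>2 / c\<^sup>2)"
  have m1: "(\<lambda>U. approx_twirl X N U A) \<in> borel_measurable M" for A
    unfolding M_def by (rule approx_twirl_measurable[OF \<mu> order_refl]) simp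
  have [measurable]: "f \<in> borel_measurable M" unfolding f_def using m1 by measurable
  have [measurable]: "op_norm \<in> borel_measurable (borel :: 'n cmatrix measure)"
    by (intro borel_measurable_continuous_onI continuous_on_op_norm)
  have [measurable]: "(\<lambda>U. op_norm (approx_twirl X N U \<rho> - R)) \<in> borel_measurable M"
    using m1 by measurable
  have "emeasure M {U \<in> space M. 1 \<le> ennreal (f U)} \<le> (\<integral>\<^sup>+U. ennreal (f U) \<partial>M)"
    using nn_integral_Markov_inequality[of "\<lambda>U. ennreal (f U)" "space M" M 1]
    by (simp add: mult.commute cong: nn_integral_cong)
  also have "\<dots> = (\<integral>\<^sup>+U. ennreal (1 / c\<^sup>2) * ennreal ((norm (approx_twirl X N U (\<rho> - R)))\<^sup>2) \<partial>M)"
    by (simp add: f_def flip: ennreal_mult)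
  also have "\<dots> = ennreal (1 / c\<^sup>2) * (\<integral>\<^sup>+U. ennreal ((norm (approx_twirl X N U (\<rho> - R)))\<^sup>2) \<partial>M)"
    using m1 by (intro nn_integral_cmult) measurable
  also have "\<dots> = ennreal ((1/2) ^ N * (norm (\<rho> - R))\<^sup>2 / c\<^sup>2)"
    unfolding M_def approx_twirl_second_moment[OF \<mu> tr] by (simp flip: ennreal_mult)
  finally have "measure M {U \<in> space M. 1 \<le> f U} \<le> (1/2) ^ N * (norm (\<rho> - R))\<^sup>2 / c\<^sup>2"
    by (simp add: M.emeasure_eq_measure)
  moreover have "measure M {U \<in> space M. \<not> op_norm (approx_twirl X N U \<rho> - R) < c}
      \<le> measure M {U \<in> space M. 1 \<le> f U}"
  proof (rule M.finite_measure_mono)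
    show "{U \<in> space M. \<not> op_norm (approx_twirl X N U \<rho> - R) < c} \<subseteq> {U \<in> space M. 1 \<le> f U}"
    proof safe
      fix U assume U: "U \<in> space M" "\<not> op_norm (approx_twirl X N U \<rho> - R) < c"
      then have "c \<le> norm (approx_twirl X N U (\<rho> - R))"
        using op_norm_le_norm[of "approx_twirl X N U \<rho> - R"] by (simp add: shift)
      then have "c\<^sup>2 \<le> (norm (approx_twirl X N U (\<rho> - R)))\<^sup>2" using c by (intro power_mono) auto
      then show "1 \<le> f U" using c by (simp add: f_def)
    qed
  qed measurable
  moreover have "measure M {U \<in> space M. \<not> op_norm (approx_twirl X N U \<rho> - R) < c}
     = 1 - measure M {U \<in> space M. op_norm (approx_twirl X N U \<rho> - R) < c}"
    by (rule M.prob_neg) measurable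
  ultimately show ?thesis by simp
qed

subsection \<open>Comparison of the thermalization times\<close>

text \<open>The partial thermalization runs for the time at which exactly the weight \<open>r = d P\<close> is left on
  the twirled state: then the maximally mixed part of \<open>\<eta>\<close> is cancelled by that of the twirled
  state.\<close>

lemma random_channel_deviation:
  fixes \<gamma> \<rho> :: "'n::finite cmatrix"
  assumes r: "r = real CARD('n) * min_eigenvalue \<gamma>" "0 < r" "r < 1" and "\<tau> > 0"
  shows "random_channel X (eta_state \<gamma>) \<tau> t\<^sub>U N (real N * t\<^sub>U - \<tau> * ln r) U \<rho> - \<gamma>
    = r *\<^sub>R (approx_twirl X N U \<rho> - (1 / real CARD('n)) *\<^sub>R mat 1)"
proof -
  define R where "R = (1 / real CARD('n)) *\<^sub>R (mat 1 :: 'n cmatrix)"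
  have eta: "eta_state \<gamma> = \<gamma> + (r / (1 - r)) *\<^sub>R (\<gamma> - R)"
    by (simp add: eta_state_def Let_def r(1) R_def)
  have "(1 - r) *\<^sub>R eta_state \<gamma> = (1 - r) *\<^sub>R \<gamma> + r *\<^sub>R (\<gamma> - R)"
    using r by (simp add: eta scaleR_add_right)
  then have "random_channel X (eta_state \<gamma>) \<tau> t\<^sub>U N (real N * t\<^sub>U - \<tau> * ln r) U \<rho>
    = r *\<^sub>R approx_twirl X N U \<rho> + ((1 - r) *\<^sub>R \<gamma> + r *\<^sub>R (\<gamma> - R))"
    using r \<open>\<tau> > 0\<close> by (simp add: random_channel_def partial_thermalization_def)
  then show ?thesis by (simp add: R_def[symmetric] algebra_simps)
qed

text \<open>The deviation from \<gamma> is exactly \<open>exp (- t / \<tau>)\<close> times the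
  initial one; solving for \<open>t\<close> gives the bound.\<close>

lemma partial_thermalization_time:
  assumes th: "thermalizes \<delta> (partial_thermalization \<tau> \<gamma> t) \<rho> \<gamma>"
    and "\<tau> > 0" "\<delta> > 0" "\<rho> \<noteq> \<gamma>"
  shows "t \<ge> \<tau> * ln (op_norm (\<rho> - \<gamma>) / \<delta>)"
proof -
  define K where "K = op_norm (\<rho> - \<gamma>)"
  have K: "K > 0" unfolding K_def using assms(4) by (intro op_norm_pos) simp
  have "partial_thermalization \<tau> \<gamma> t \<rho> - \<gamma> = exp (- t / \<tau>) *\<^sub>R (\<rho> - \<gamma>)"
    by (simp add: partial_thermalization_def algebra_simps)
  then have "exp (- t / \<tau>) * K < \<delta>"
    using th by (simp add: thermalizes_def op_norm_scaleR K_def)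
  then have "K / \<delta> < exp (t / \<tau>)"
    using assms(3) by (simp add: exp_minus field_simps)
  then have "ln (K / \<delta>) < ln (exp (t / \<tau>))"
    using K assms(3) by (intro ln_less_cancel_iff[THEN iffD2]) auto
  then show ?thesis using assms(2) by (simp add: K_def field_simps)
qed

theorem theorem7:
  fixes X :: subsystem
    and H \<gamma> \<eta> \<rho> :: "'n::finite cmatrix"
    and \<mu> :: "'n cmatrix measure"
    and d P k T t\<^sub>U \<tau>\<^sub>\<gamma> \<tau>\<^sub>\<eta> p :: real
  assumes "CARD('n) \<ge> 2" and "d = real CARD('n)"
    and "hermitian H" and "non_degenerate H"
    and "k > 0" and "T > 0"
    and "\<gamma> = thermal_state k T H"
    and "P = min_eigenvalue \<gamma>"
    and "\<eta> = eta_state \<gamma>"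
    and "t\<^sub>U > 0" and "\<tau>\<^sub>\<gamma> > 0" and "\<tau>\<^sub>\<eta> > 0"
    and "haar_measure \<mu>"
    and "\<tau>\<^sub>\<gamma> > t\<^sub>U * (8 / ln 2)"
    and "state \<rho>" and "\<rho> \<noteq> \<gamma>"
    and "0 < p" and "p < 1"
  shows "\<exists>\<delta>'>0. \<forall>\<delta>. 0 < \<delta> \<and> \<delta> < \<delta>' \<longrightarrow>
    (let N = nat \<lceil>8 * log 2 (d\<^sup>2 * P * sqrt 2 / \<delta>)\<rceil>;
         q = 1 - (\<delta> / (d\<^sup>2 * P * sqrt 2)) ^ 4
     in \<exists>t\<^sub>1 t\<^sub>2. real N * t\<^sub>U \<le> t\<^sub>1 \<and>
          success_probability \<mu> N
            (\<lambda>U. thermalizes \<delta> (random_channel X \<eta> \<tau>\<^sub>\<eta> t\<^sub>U N t\<^sub>1 U) \<rho> \<gamma>) \<ge> q \<and>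
          q > p \<and>
          (\<forall>t\<ge>0. thermalizes \<delta> (partial_thermalization \<tau>\<^sub>\<gamma> \<gamma> t) \<rho> \<gamma> \<longrightarrow> t \<ge> t\<^sub>2) \<and>
          t\<^sub>1 < t\<^sub>2)"
proof -
  define c where "c = d\<^sup>2 * P * sqrt 2"
  define r where "r = d * P"
  define R where "R = (1 / real CARD('n)) *\<^sub>R (mat 1 :: 'n cmatrix)"
  define C where "C = norm (\<rho> - R)"
  define K where "K = op_norm (\<rho> - \<gamma>)"
  \<comment> \<open>The growth rate of the twirling time:
    \<open>8 * log 2 (c / \<delta>) * t\<^sub>U = a * ln (c / \<delta>)\<close>.\<close>
  define a where "a = t\<^sub>U * (8 / ln 2)"
  \<comment> \<open>Collects the terms free of \<delta>, so that \<open>t\<^sub>1 - t\<^sub>2 \<le>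
    b + (\<tau>\<^sub>\<gamma> - a) * ln \<delta>\<close>.\<close>
  define b where "b = a * ln c + t\<^sub>U - \<tau>\<^sub>\<eta> * ln r - \<tau>\<^sub>\<gamma> * ln K"
  have P: "0 < P" "d * P < 1"
    using thermal_state_min_eigenvalue[OF assms(3,4,1,5,6)] assms(2,7,8) by simp_all
  have d: "d > 0" using assms(1,2) by simp
  have c: "c > 0" using P d by (simp add: c_def)
  have r: "r = real CARD('n) * min_eigenvalue \<gamma>" "0 < r" "r < 1"
    using P d assms(2,8) by (simp_all add: r_def)
  have K: "K > 0" unfolding K_def using assms(16) by (intro op_norm_pos) simp
  have a: "a < \<tau>\<^sub>\<gamma>" using assms(14) by (simp add: a_def)
  have C: "C \<ge> 0" by (simp add: C_def)
  \<comment> \<open>In order, the four bounds make the logarithm in \<open>N\<close> positive, make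
    the promised probability exceed \<open>p\<close>, absorb the factor \<open>C\<^sup>2\<close> of
    the Markov bound, and give \<open>t\<^sub>1 < t\<^sub>2\<close>. The \<open>+ 1\<close> keeps
    the denominator positive when \<open>r * C = 0\<close>.\<close>
  define \<delta>' where "\<delta>' = Min {c, c * (1 - p), c\<^sup>2 / (r * C + 1), exp (- b / (\<tau>\<^sub>\<gamma> - a))}"
  have "\<delta>' > 0" using c r C assms(18) by (simp add: \<delta>'_def add_nonneg_pos)
  moreover have "\<exists>t\<^sub>1 t\<^sub>2. real N * t\<^sub>U \<le> t\<^sub>1 \<and>
          success_probability \<mu> N
            (\<lambda>U. thermalizes \<delta> (random_channel X \<eta> \<tau>\<^sub>\<eta> t\<^sub>U N t\<^sub>1 U) \<rho> \<gamma>) \<ge> 1 - (\<delta> / c) ^ 4 \<and>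
          1 - (\<delta> / c) ^ 4 > p \<and>
          (\<forall>t\<ge>0. thermalizes \<delta> (partial_thermalization \<tau>\<^sub>\<gamma> \<gamma> t) \<rho> \<gamma> \<longrightarrow> t \<ge> t\<^sub>2) \<and>
          t\<^sub>1 < t\<^sub>2"
    if \<delta>: "0 < \<delta>" "\<delta> < \<delta>'" and N: "N = nat \<lceil>8 * log 2 (c / \<delta>)\<rceil>" for \<delta> N
  proof (intro exI conjI allI impI)
    define \<epsilon> where "\<epsilon> = \<delta> / c"
    have \<delta>c: "\<delta> < c" "\<delta> < c * (1 - p)" "\<delta> < c\<^sup>2 / (r * C + 1)" "\<delta> < exp (- b / (\<tau>\<^sub>\<gamma> - a))"
      using \<delta>(2) by (simp_all add: \<delta>'_def)
    have \<epsilon>: "0 < \<epsilon>" "\<epsilon> < 1" "\<epsilon> < 1 - p"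
      using \<delta>(1) \<delta>c c by (simp_all add: \<epsilon>_def field_simps)
    have log: "log 2 (c / \<delta>) > 0" using \<delta>(1) \<delta>c(1) by simp
    \<comment> \<open>The logarithm is positive, so \<open>nat\<close> truncates nothing. The
      \<open>+ 1\<close> is the cost of the ceiling and reappears as the summand
      \<open>t\<^sub>U\<close> of \<open>b\<close>.\<close>
    have Nge: "8 * log 2 (c / \<delta>) \<le> real N" and Nle: "real N \<le> 8 * log 2 (c / \<delta>) + 1"
      using log unfolding N by simp_all
    define t\<^sub>1 where "t\<^sub>1 = real N * t\<^sub>U - \<tau>\<^sub>\<eta> * ln r"
    define t\<^sub>2 where "t\<^sub>2 = \<tau>\<^sub>\<gamma> * ln (K / \<delta>)"
    show "real N * t\<^sub>U \<le> t\<^sub>1"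
      using r assms(12) by (simp add: t\<^sub>1_def mult_nonneg_nonpos)
    show "t\<^sub>2 \<le> t" if "thermalizes \<delta> (partial_thermalization \<tau>\<^sub>\<gamma> \<gamma> t) \<rho> \<gamma>" for t
      unfolding t\<^sub>2_def K_def by (rule partial_thermalization_time[OF that assms(11) \<delta>(1) assms(16)])
    show "p < 1 - (\<delta> / c) ^ 4"
    proof -
      have "\<epsilon> ^ 4 \<le> \<epsilon> ^ 1" using \<epsilon> by (intro power_decreasing) auto
      then show ?thesis using \<epsilon>(3) by (simp add: \<epsilon>_def)
    qed
    show "t\<^sub>1 < t\<^sub>2"
    proof -
      have "real N * t\<^sub>U \<le> (8 * log 2 (c / \<delta>) + 1) * t\<^sub>U"
        using Nle assms(10) by (simp add: mult_right_mono)
      also have "\<dots> = a * (ln c - ln \<delta>) + t\<^sub>U"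
        using c \<delta>(1) by (simp add: a_def log_def ln_div field_simps)
      finally have "t\<^sub>1 \<le> a * ln c - a * ln \<delta> + t\<^sub>U - \<tau>\<^sub>\<eta> * ln r"
        by (simp add: t\<^sub>1_def algebra_simps)
      moreover have "ln \<delta> < - b / (\<tau>\<^sub>\<gamma> - a)"
        using \<delta>(1) \<delta>c(4) by (metis ln_exp ln_less_cancel_iff exp_gt_zero)
      then have "(\<tau>\<^sub>\<gamma> - a) * ln \<delta> < - b" using a by (simp add: field_simps)
      moreover have "t\<^sub>2 = \<tau>\<^sub>\<gamma> * ln K - \<tau>\<^sub>\<gamma> * ln \<delta>"
        using K \<delta>(1) by (simp add: t\<^sub>2_def ln_div right_diff_distrib)
      ultimately show ?thesis by (simp add: b_def algebra_simps)
    qed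
    show "1 - (\<delta> / c) ^ 4 \<le> success_probability \<mu> N
        (\<lambda>U. thermalizes \<delta> (random_channel X \<eta> \<tau>\<^sub>\<eta> t\<^sub>U N t\<^sub>1 U) \<rho> \<gamma>)"
    proof -
      have "thermalizes \<delta> (random_channel X \<eta> \<tau>\<^sub>\<eta> t\<^sub>U N t\<^sub>1 U) \<rho> \<gamma>
          \<longleftrightarrow> op_norm (approx_twirl X N U \<rho> - R) < \<delta> / r" for U
        unfolding thermalizes_def assms(9) t\<^sub>1_def random_channel_deviation[OF r assms(12)]
          op_norm_scaleR R_def[symmetric]
        using r(2) by (simp add: pos_less_divide_eq mult.commute)
      then have "success_probability \<mu> N
          (\<lambda>U. thermalizes \<delta> (random_channel X \<eta> \<tau>\<^sub>\<eta> t\<^sub>U N t\<^sub>1 U) \<rho> \<gamma>)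
          \<ge> 1 - (1/2) ^ N * C\<^sup>2 / (\<delta> / r)\<^sup>2"
        using approx_twirl_concentration[OF assms(13), of \<rho> "\<delta> / r" N X] assms(15) \<delta>(1) r(2)
        by (simp add: success_probability_def Let_def C_def R_def state_def)
      moreover have "(1/2) ^ N * C\<^sup>2 / (\<delta> / r)\<^sup>2 \<le> \<epsilon> ^ 4"
      proof -
        have "(1/2) ^ N = 2 powr (- real N)"
          by (simp add: powr_minus powr_realpow power_one_over inverse_eq_divide)
        also have "\<dots> \<le> 2 powr (8 * log 2 \<epsilon>)"
          using Nge c \<delta>(1) by (simp add: \<epsilon>_def log_divide)
        also have "\<dots> = (2 powr log 2 \<epsilon>) powr 8"
          by (simp only: powr_powr mult.commute)
        also have "\<dots> = \<epsilon> ^ 8"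
          using \<epsilon>(1) by simp
        finally have "(1/2) ^ N * C\<^sup>2 / (\<delta> / r)\<^sup>2 \<le> \<epsilon> ^ 8 * C\<^sup>2 / (\<delta> / r)\<^sup>2"
          by (intro divide_right_mono mult_right_mono) auto
        \<comment> \<open>The factor 8 in \<open>N\<close> yields \<open>\<epsilon> ^ 8\<close>.
          Half of these powers form the promised failure probability; the others compensate
          \<open>C\<^sup>2 / (\<delta> / r)\<^sup>2\<close>, since
          \<open>\<epsilon>\<^sup>2 / \<delta> = \<epsilon> / c\<close>.\<close>
        also have "\<dots> = \<epsilon> ^ 4 * (\<epsilon> * (r * C) / c)\<^sup>2"
          using c \<delta>(1) by (simp add: \<epsilon>_def field_simps eval_nat_numeral)
        also have "\<dots> \<le> \<epsilon> ^ 4 * 1\<^sup>2"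
        proof (intro mult_left_mono power_mono)
          have "\<delta> * (r * C + 1) \<le> c\<^sup>2"
            using \<delta>c(3) r C by (simp add: pos_less_divide_eq add_nonneg_pos)
          then have "\<delta> * (r * C) \<le> c\<^sup>2" using \<delta>(1) by (simp add: algebra_simps)
          then show "\<epsilon> * (r * C) / c \<le> 1"
            using c by (simp add: \<epsilon>_def power2_eq_square divide_le_eq)
        qed (use \<epsilon> r C c in auto)
        finally show ?thesis by simp
      qed
      ultimately show ?thesis by (simp add: \<epsilon>_def)
    qed
  qed
  ultimately show ?thesis unfolding Let_def c_def[symmetric] by blast
qed

end
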